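(* Assume that $\mathbb{S}(\Omega)\subset\Omega$. If $\beta\in\Omega\cap U$, then the girth of $\Gamma(\Omega,q)$ is at least $2(|\beta|+2)$.
   Context: Let $q$ be a prime power and $\mathbb{F}_q$ the field with $q$ elements. $\{0,1\}^*$ is the set of finite binary sequences, $\eta$ the null sequence; juxtaposition is concatenation; $|\beta|$ is the length of $\beta$. $\Omega\subset\{0,1\}^*$ is a finite set satisfying condition C1: $\eta\in\Omega$, and for any $\alpha\in\Omega\setminus\{\eta\}$ the sequence obtained by deleting the last bit of $\alpha$ is in $\Omega$. $L(\Omega)$ and $R(\Omega)$ are two disjoint copies of $\mathbb{F}_q^{|\Omega|+1}$; their vectors are written $[l]$ and $\langle r\rangle$ respectively, with entries indexed by $\Omega\cup\{*\}$, where $*\notin\Omega$ is an extra symbol. $\Gamma(\Omega,q)$ is the bipartite graph with vertex set $L(\Omega)\cup R(\Omega)$ in which $[l]\in L(\Omega)$ and $\langle r\rangle\in R(\Omega)$ are adjacent if and only if $l_\eta+r_\eta=l_*r_*$, $l_{\alpha0}+r_{\alpha0}=r_*l_\alpha$ for all $\alpha0\in\Omega$, and $l_{\beta1}+r_{\beta1}=l_*r_\beta$ for all $\beta1\in\Omega$ (here $\alpha,\beta\in\{0,1\}^*$). For $\alpha\in\Omega$, $S_\Omega(\alpha)$ is the set of $\beta\in\{0,1\}^*$ with $\{\alpha01\beta,\alpha10\beta\}\cap\Omega\ne\emptyset$, and $\mathbb{S}(\Omega)=\bigcup_{\alpha\in\Omega}S_\Omega(\alpha)$. $U=\{\eta,0,1,01,10,010,101,0101,1010,\ldots\}$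 is the set of all alternating binary sequences (no two consecutive bits equal), including $\eta$. *)

theory Defs
  imports "HOL-Library.FuncSet" "HOL-Library.Extended_Nat"
begin

section \<open>Simple graphs and girth\<close>

type_synonym 'v graph = "'v set \<times> 'v set set"

abbreviation vertices :: "'v graph \<Rightarrow> 'v set" where
  "vertices G \<equiv> fst G"

abbreviation edges :: "'v graph \<Rightarrow> 'v set set" where
  "edges G \<equiv> snd G"

text \<open>A cycle is given by the list of its vertices, the starting vertex not being repeated at the
  end; hence the length of the list is the length of the cycle.\<close>

definition is_cycle :: "'v graph \<Rightarrow> 'v list \<Rightarrow> bool" where
  "is_cycle G p \<longleftrightarrow>
     length p \<ge> 3 \<and> distinct p \<and> set p \<subseteq> vertices G \<and>
     (\<forall>i < length p. {p ! i, p ! (Suc i mod length p)} \<in> edges G)"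

text \<open>The girth of an acyclic graph is \<open>\<infinity>\<close>, the infimum of the empty set.\<close>

definition girth :: "'v graph \<Rightarrow> enat" where
  "girth G = (INF p \<in> {p. is_cycle G p}. enat (length p))"


section \<open>Binary sequences\<close>

text \<open>The bits 0 and 1 are \<open>False\<close> and \<open>True\<close>; the first bit of a sequence is the head of the list.\<close>

type_synonym binseq = "bool list"

definition C1 :: "binseq set \<Rightarrow> bool" where
  "C1 \<Omega> \<longleftrightarrow> [] \<in> \<Omega> \<and> (\<forall>\<alpha> \<in> \<Omega> - {[]}. butlast \<alpha> \<in> \<Omega>)"

definition S :: "binseq set \<Rightarrow> binseq \<Rightarrow> binseq set" where
  "S \<Omega> \<alpha> = {\<beta>. {\<alpha> @ [False, True] @ \<beta>, \<alpha> @ [True, False] @ \<beta>} \<inter> \<Omega> \<noteq> {}}"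

definition SS :: "binseq set \<Rightarrow> binseq set" where
  "SS \<Omega> = (\<Union>\<alpha> \<in> \<Omega>. S \<Omega> \<alpha>)"

definition U :: "binseq set" where
  "U = {\<beta>. successively (\<noteq>) \<beta>}"


section \<open>The graph\<close>

text \<open>The extra index \<open>*\<close> is \<open>None\<close>. Vectors are extensional functions on the index set, so that
  there are exactly \<open>CARD('a) ^ (card \<Omega> + 1)\<close> of them.\<close>

type_synonym 'a vec = "binseq option \<Rightarrow> 'a"

definition vecs :: "binseq set \<Rightarrow> 'a vec set" where
  "vecs \<Omega> = insert None (Some ` \<Omega>) \<rightarrow>\<^sub>E UNIV"

definition adjacent :: "binseq set \<Rightarrow> 'a::field vec \<Rightarrow> 'a vec \<Rightarrow> bool" where
  "adjacent \<Omega> l r \<longleftrightarrow>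
     l (Some []) + r (Some []) = l None * r None \<and>
     (\<forall>\<alpha>. \<alpha> @ [False] \<in> \<Omega> \<longrightarrow>
        l (Some (\<alpha> @ [False])) + r (Some (\<alpha> @ [False])) = r None * l (Some \<alpha>)) \<and>
     (\<forall>\<beta>. \<beta> @ [True] \<in> \<Omega> \<longrightarrow>
        l (Some (\<beta> @ [True])) + r (Some (\<beta> @ [True])) = l None * r (Some \<beta>))"

text \<open>The two disjoint copies of the vector space are tagged by \<open>Inl\<close> (for \<open>[l]\<close>) and \<open>Inr\<close>
  (for \<open>\<langle>r\<rangle>\<close>).\<close>

definition Gamma :: "binseq set \<Rightarrow> ('a::field vec + 'a vec) graph" where
  "Gamma \<Omega> =
     (Inl ` vecs \<Omega> \<union> Inr ` vecs \<Omega>,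
      {{Inl l, Inr r} | l r. l \<in> vecs \<Omega> \<and> r \<in> vecs \<Omega> \<and> adjacent \<Omega> l r})"

end

theory Submission
  imports Defs
begin

text \<open>
  Call the entry at the index \<open>*\<close> the colour of a vertex, and follow a closed walk
  \<open>u 0, u 1, \<dots>, u (2 * k) = u 0\<close> that never turns back. Passing from the edge
  \<open>{u t, u (t + 1)}\<close> to the next edge replaces \<open>u t\<close> by \<open>u (t + 2)\<close>; both are neighbours of
  \<open>u (t + 1)\<close>, so they differ in colour, by the jump \<open>\<delta> t \<noteq> 0\<close>. Subtracting the adjacency
  equations of the two edges shows that, if the side of \<open>u t\<close> corresponds to the bit \<open>b\<close>, the
  coordinate \<open>\<alpha>b\<close> changes by \<open>\<delta> t\<close> times the coordinate \<open>\<alpha>\<close> of the other vertex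
  \<open>u (t + 1)\<close>. For an alternating word all these increments fit together: its coordinate is an
  iterated sum (a discrete iterated integral) of jumps alternating between the two sides, plus
  shorter iterated sums weighted by the coordinates that the walk starts from
  (\<open>level_expansion\<close>).

  After one full turn every coordinate has its initial value, which gives linear relations
  between the iterated sums over the turn. A shorter sum belongs to a suffix of the word, and
  the hypothesis on \<open>SS \<Omega>\<close> says that deleting two or more leading bits of an alternating word
  does not lead out of \<open>\<Omega>\<close>; so by induction the shorter sums vanish (\<open>itsum_turn_eq_0\<close>).
  Deleting exactly one bit may lead out of \<open>\<Omega>\<close>. Therefore the relation of a word with \<open>i - 1\<close>
  bits keeps two terms: the sum of depth \<open>i + 1\<close>, and \<open>c\<close> times the sum of depth \<open>i\<close>, where
  \<open>c\<close> is the colour of \<open>u 1\<close> (\<open>turn_leading_relation\<close>).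

  Let \<open>H i t\<close> be this combination, accumulated up to time \<open>t\<close>. For \<open>i \<ge> 1\<close> it vanishes at both
  ends of the turn. Seen from the start, \<open>k\<close> jumps are just enough to make \<open>H k\<close> nonzero: it is \<open>c\<close>
  times the product of the first \<open>k\<close> jumps. Seen from the end, the jumps come with the opposite
  parity, so that the first one is wasted and \<open>k\<close> steps back \<open>H k\<close> is still zero. The two
  meet at time \<open>k\<close>, a contradiction if \<open>c \<noteq> 0\<close> (\<open>midpoint_contradiction\<close>). Now if \<open>\<Omega>\<close>
  contains an alternating word of length \<open>n\<close>, a cycle of length \<open>2 * k \<le> 2 * (n + 1)\<close> would be
  such a walk: a prefix of length \<open>k - 1\<close> of the word is in \<open>\<Omega>\<close>, and since colours at distance
  two differ, the walk can be started so that the colour of \<open>u 1\<close> is not zero.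
\<close>

section \<open>Iterated sums of jumps\<close>

text \<open>
  The sum of \<open>\<delta> t\<^sub>1 * \<dots> * \<delta> t\<^sub>m\<close> over all \<open>t\<^sub>1 < \<dots> < t\<^sub>m < t\<close> whose sides alternate and
  end with the side \<open>b\<close>. Both sides are booleans; the side that moves at time \<open>t\<close> is
  \<open>s = even t\<close>, that is \<open>s\<close> at even and \<open>\<not> s\<close> at odd times.
\<close>

fun itsum :: "bool \<Rightarrow> (nat \<Rightarrow> 'a::comm_ring_1) \<Rightarrow> bool \<Rightarrow> nat \<Rightarrow> nat \<Rightarrow> 'a" where
  "itsum s \<delta> b 0 t = 1"
| "itsum s \<delta> b (Suc m) 0 = 0"
| "itsum s \<delta> b (Suc m) (Suc t) =
     itsum s \<delta> b (Suc m) t + (if b = (s = even t) then \<delta> t * itsum s \<delta> (\<not> b) m t else 0)"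

lemma itsum_eq_0: "t < m \<Longrightarrow> itsum s \<delta> b m t = 0"
proof (induction t arbitrary: b m)
  case 0
  then show ?case by (cases m) auto
next
  case (Suc t)
  then show ?case by (cases m) auto
qed

text \<open>Only one choice of \<open>m\<close> times below \<open>m\<close> exists. The side \<open>s = odd m\<close> is the one that moves
  at the last of these times, \<open>m - 1\<close>.\<close>

lemma itsum_diagonal: "itsum s \<delta> (s = odd m) m m = (\<Prod>t<m. \<delta> t)"
proof (induction m)
  case (Suc m)
  have "(\<not> (s = odd (Suc m))) = (s = odd m)" by auto
  then show ?case using Suc by (simp add: itsum_eq_0 mult.commute)
qed simp

text \<open>
  The core of the argument, free of graphs. The combinations \<open>H i\<close> of the hypothesis satisfy the
  recursion of iterated sums in which \<open>H 0\<close>, which is \<open>c\<close> at time 0, takes the place of the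
  constant 1. At the time \<open>k\<close>, half of the turn, the forward computation of \<open>H k\<close> from the time
  0 and the backward one from the time \<open>2 * k\<close> give different results.
\<close>

lemma midpoint_contradiction:
  fixes \<delta> :: "nat \<Rightarrow> 'a::idom"
  assumes turn: "\<And>i. \<lbrakk>1 \<le> i; i \<le> k\<rbrakk> \<Longrightarrow>
      itsum s \<delta> (s = odd i) (Suc i) (2 * k) + c * itsum s \<delta> (s = odd i) i (2 * k) = 0"
    and "k \<ge> 1" and "c \<noteq> 0" and "\<And>t. \<delta> t \<noteq> 0"
  shows False
proof -
  define H where
    "H i t = itsum s \<delta> (s = odd i) (Suc i) t + c * itsum s \<delta> (s = odd i) i t" for i t
  have H_Suc: "H (Suc i) (Suc t) =
      H (Suc i) t + (if odd i = odd t then \<delta> t * H i t else 0)" for i t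
  proof -
    have "(\<not> (s = odd (Suc i))) = (s = odd i)" by auto
    then show ?thesis by (auto simp: H_def algebra_simps)
  qed
  \<comment> \<open>The level \<open>i\<close> moves at times of the parity of \<open>i - 1\<close>. The last jump, at \<open>2 * k - 1\<close>, is
    odd and does not move the level 1; hence going back from the end of the turn the level \<open>i\<close>
    cannot leave 0 before the step \<open>i + 1\<close>.\<close>
  have backward: "H i (2 * k - r) = 0" if "1 \<le> i" "i \<le> k" "r \<le> i" for i r
    using that
  proof (induction r arbitrary: i)
    case 0
    then show ?case using turn by (simp add: H_def)
  next
    case (Suc r)
    define t where "t = 2 * k - Suc r"
    have t: "2 * k - r = Suc t" "odd t = even r"
      using Suc.prems by (auto simp: t_def)
    obtain j where j: "i = Suc j" using Suc.prems by (cases i) auto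
    have st: "H i (Suc t) = 0" using Suc t by simp
    show ?case
    proof (cases "odd j = odd t")
      case True
      then have p: "odd j = even r" using t by simp
      \<comment> \<open>The parity improves \<open>r \<le> j\<close> by one, so the level \<open>j\<close> below is still zero.\<close>
      then have "r \<noteq> j" by auto
      then have "Suc r \<le> j" using Suc.prems j by auto
      then have "H j (Suc t) = 0" using Suc t j by auto
      moreover have "H j (Suc t) = H j t"
      proof -
        obtain j' where "j = Suc j'" using \<open>Suc r \<le> j\<close> by (cases j) auto
        then show ?thesis using H_Suc[of j' t] True by auto
      qed
      ultimately show ?thesis using st H_Suc[of j t] j unfolding t_def[symmetric] by (simp split: if_splits)
    next
      case False
      then show ?thesis using st H_Suc[of j t] j by (simp add: t_def[symmetric])
    qed
  qed
  have "H k (2 * k - k) = 0" using backward assms(2) by blast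
  moreover have "H k k = c * (\<Prod>t<k. \<delta> t)"
    by (simp add: H_def itsum_eq_0 itsum_diagonal)
  ultimately show False using assms by simp
qed

section \<open>Alternating words\<close>

text \<open>The alternating word is determined by its last bit \<open>b\<close>, as adjacency equations and
  iterated sums are peeled off from the last bit.\<close>

fun altw :: "bool \<Rightarrow> nat \<Rightarrow> binseq" where
  "altw b 0 = []"
| "altw b (Suc n) = altw (\<not> b) n @ [b]"

lemma altw_of_U: "\<beta> \<in> U \<Longrightarrow> \<exists>b. \<beta> = altw b (length \<beta>)"
proof (induction \<beta> rule: rev_induct)
  case (snoc b \<beta>)
  then have a: "\<beta> \<in> U" "\<beta> \<noteq> [] \<Longrightarrow> last \<beta> = (\<not> b)"
    by (auto simp: U_def successively_append_iff)
  from snoc.IH[OF a(1)] obtain d where d: "\<beta> = altw d (length \<beta>)" by blast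
  have "\<beta> = altw (\<not> b) (length \<beta>)"
  proof (cases "length \<beta>")
    case (Suc n)
    then have "last \<beta> = d" by (subst d) simp
    then show ?thesis using d a(2) Suc by auto
  qed simp
  then show ?case by (intro exI[of _ b]) simp
qed simp

lemma altw_append: "\<exists>d. altw b (m + n) = altw d m @ altw b n"
proof (induction n arbitrary: b)
  case (Suc n)
  then obtain d where "altw (\<not> b) (m + n) = altw d m @ altw (\<not> b) n" by blast
  then show ?case by auto
qed auto

lemma C1_prefix: "C1 \<Omega> \<Longrightarrow> \<alpha> @ \<gamma> \<in> \<Omega> \<Longrightarrow> \<alpha> \<in> \<Omega>"
proof (induction \<gamma> rule: rev_induct)
  case (snoc b \<gamma>)
  have "butlast (\<alpha> @ \<gamma> @ [b]) \<in> \<Omega>" using snoc.prems unfolding C1_def by blast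
  then show ?case using snoc by (simp add: butlast_append)
qed simp

lemma altw_prefix: "C1 \<Omega> \<Longrightarrow> altw b (Suc n) \<in> \<Omega> \<Longrightarrow> altw (\<not> b) n \<in> \<Omega>"
  using C1_prefix by auto

text \<open>
  If at least two bits are deleted, the last two of them are distinct, so the word has the form
  \<open>\<alpha>01\<gamma>\<close> or \<open>\<alpha>10\<gamma>\<close> with the remaining word \<open>\<gamma>\<close>. This is the only way in which the
  condition on \<open>SS \<Omega>\<close> enters.
\<close>

lemma altw_suffix:
  assumes "C1 \<Omega>" "SS \<Omega> \<subseteq> \<Omega>" "altw b n \<in> \<Omega>" "m + 2 \<le> n"
  shows "altw b m \<in> \<Omega>"
proof -
  obtain d where d: "altw b n = altw d (n - m) @ altw b m"
    using altw_append[of b "n - m" m] assms(4) by auto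
  obtain j where "n - m = Suc (Suc j)" 
    using assms(4) by (intro that[of "n - m - 2"]) simp
  then have e: "altw b n = altw d j @ [\<not> d, d] @ altw b m" using d by simp
  then have "altw d j \<in> \<Omega>" using C1_prefix assms by metis
  moreover have "altw b m \<in> S \<Omega> (altw d j)"
    using e assms(3) by (cases d) (auto simp: S_def)
  ultimately show ?thesis using assms(2) by (auto simp: SS_def)
qed

section \<open>Edges\<close>

definition coord :: "'a vec + 'a vec \<Rightarrow> 'a vec" where
  "coord v = case_sum id id v"

abbreviation colour :: "'a vec + 'a vec \<Rightarrow> 'a" where
  "colour v \<equiv> coord v None"

lemma edge_cases:
  assumes "{v, w} \<in> edges (Gamma \<Omega>)"
  obtains l r where "v = Inl l" "w = Inr r" "l \<in> vecs \<Omega>" "r \<in> vecs \<Omega>" "adjacent \<Omega> l r"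
  | l r where "v = Inr r" "w = Inl l" "l \<in> vecs \<Omega>" "r \<in> vecs \<Omega>" "adjacent \<Omega> l r"
  using assms by (auto simp: Gamma_def doubleton_eq_iff)

lemma edge_isl: "{v, w} \<in> edges (Gamma \<Omega>) \<Longrightarrow> isl w = (\<not> isl v)"
  by (erule edge_cases) auto

lemma edge_Nil:
  "{v, w} \<in> edges (Gamma \<Omega>) \<Longrightarrow>
    coord v (Some []) + coord w (Some []) = colour v * colour w"
  by (erule edge_cases) (auto simp: coord_def adjacent_def ac_simps)

text \<open>Identifying the bit 1 with the left and 0 with the right side turns the two families of
  adjacency equations into one that is symmetric in the sides: the vertex on the side of the last
  bit contributes its colour, the other one its coordinate. This saves every later argument from
  being done twice.\<close>

lemma edge_snoc:
  assumes "{v, w} \<in> edges (Gamma \<Omega>)" "\<alpha> @ [isl v] \<in> \<Omega>"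
  shows "coord v (Some (\<alpha> @ [isl v])) + coord w (Some (\<alpha> @ [isl v])) =
    colour v * coord w (Some \<alpha>)"
  using assms(1)
  by (rule edge_cases) (use assms(2) in \<open>auto simp: coord_def adjacent_def ac_simps\<close>)

text \<open>The adjacency equations determine all coordinates of a neighbour of \<open>x\<close> recursively from its
  colour. This is what makes the jumps along a walk that never turns back nonzero.\<close>

lemma neighbour_eqI:
  assumes "C1 \<Omega>" and v: "{v, x} \<in> edges (Gamma \<Omega>)" and w: "{w, x} \<in> edges (Gamma \<Omega>)"
    and "colour v = colour w"
  shows "v = w"
proof -
  have isl: "isl v = isl w" "isl x = (\<not> isl v)" "isl x = (\<not> isl w)"
    using edge_isl v w by blast+
  have xv: "{x, v} \<in> edges (Gamma \<Omega>)" and xw: "{x, w} \<in> edges (Gamma \<Omega>)"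
    using v w by (simp_all add: insert_commute)
  have eq: "coord v (Some \<alpha>) = coord w (Some \<alpha>)" if "\<alpha> \<in> \<Omega>" for \<alpha>
    using that
  proof (induction \<alpha> rule: rev_induct)
    case Nil
    show ?case using edge_Nil[OF v] edge_Nil[OF w] assms(4) by (metis add_right_cancel)
  next
    case (snoc b \<alpha>)
    then have IH: "coord v (Some \<alpha>) = coord w (Some \<alpha>)" using C1_prefix assms(1) by blast
    show ?case
    proof (cases "b = isl v")
      case True
      then have "\<alpha> @ [isl v] \<in> \<Omega>" "\<alpha> @ [isl w] \<in> \<Omega>"
        using snoc.prems isl(1) by simp_all
      from edge_snoc[OF v this(1)] edge_snoc[OF w this(2)]
      have "coord v (Some (\<alpha> @ [b])) + coord x (Some (\<alpha> @ [b])) =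
          coord w (Some (\<alpha> @ [b])) + coord x (Some (\<alpha> @ [b]))"
        unfolding isl(1)[symmetric] True[symmetric] assms(4) by simp
      then show ?thesis by (rule add_right_imp_eq)
    next
      case False
      then have b: "\<alpha> @ [isl x] = \<alpha> @ [b]" using isl by auto
      then have "\<alpha> @ [isl x] \<in> \<Omega>" using snoc.prems by simp
      from edge_snoc[OF xv this] edge_snoc[OF xw this]
      have "coord x (Some (\<alpha> @ [b])) + coord v (Some (\<alpha> @ [b])) =
          coord x (Some (\<alpha> @ [b])) + coord w (Some (\<alpha> @ [b]))"
        unfolding b IH by simp
      then show ?thesis by (rule add_left_imp_eq)
    qed
  qed
  have "coord v \<in> vecs \<Omega>" "coord w \<in> vecs \<Omega>"
    using v w by (auto elim!: edge_cases simp: coord_def)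
  then have "coord v = coord w"
    unfolding vecs_def by (rule PiE_ext) (use eq assms(4) in auto)
  then show ?thesis using isl(1) by (cases v; cases w) (auto simp: coord_def)
qed

section \<open>Closed walks\<close>

text \<open>The time \<open>t\<close> stands for the edge \<open>{u t, u (Suc t)}\<close>. It has a vertex on either side, so
  that coordinates of both sides are available at every time.\<close>

locale closed_walk =
  fixes \<Omega> :: "binseq set" and u :: "nat \<Rightarrow> 'a::field vec + 'a vec" and T :: nat and s :: bool
  assumes C1: "C1 \<Omega>"
    and edge: "{u t, u (Suc t)} \<in> edges (Gamma \<Omega>)"
    and isl_u: "isl (u t) = (s = even t)"
    and closed: "u (t + T) = u t"
begin

definition jump :: "nat \<Rightarrow> 'a" where
  "jump t = colour (u (Suc (Suc t))) - colour (u t)"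

text \<open>The vertex on the side \<open>b\<close> of the edge at time \<open>t\<close>.\<close>

definition vert :: "bool \<Rightarrow> nat \<Rightarrow> 'a vec + 'a vec" where
  "vert b t = (if b = isl (u t) then u t else u (Suc t))"

text \<open>The coordinates at alternating words, numbered by the depth of their iterated sums: the
  constant 1 and the colour, of depths 0 and 1, precede the coordinate of the empty word.\<close>

fun level :: "bool \<Rightarrow> nat \<Rightarrow> nat \<Rightarrow> 'a" where
  "level b 0 t = 1"
| "level b (Suc 0) t = colour (vert b t)"
| "level b (Suc (Suc n)) t = coord (vert b t) (Some (altw b n))"

lemma level_closed: "level b m T = level b m 0"
proof -
  have "vert b T = vert b 0" using closed[of 0] closed[of 1] by (simp add: vert_def)
  then show ?thesis by (cases "(b, m, T)" rule: level.cases) auto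
qed

text \<open>Either the vertex on the side \<open>b\<close> stays, or it is replaced by another neighbour of the
  same vertex \<open>u (Suc t)\<close>; then the adjacency equations of the two edges are
  subtracted.\<close>

lemma level_Suc:
  assumes "altw b (m - 1) \<in> \<Omega>"
  shows "level b (Suc m) (Suc t) =
    level b (Suc m) t + (if b = (s = even t) then jump t * level (\<not> b) m t else 0)"
proof (cases "b = (s = even t)")
  case False
  then have "vert b (Suc t) = vert b t" by (auto simp: vert_def isl_u)
  then show ?thesis using False by (cases m) auto
next
  case True
  then have v: "vert b t = u t" "vert b (Suc t) = u (Suc (Suc t))" "vert (\<not> b) t = u (Suc t)"
    and b: "b = isl (u t)" "b = isl (u (Suc (Suc t)))"
    by (auto simp: vert_def isl_u)
  note e1 = edge[of t]
  have e2: "{u (Suc (Suc t)), u (Suc t)} \<in> edges (Gamma \<Omega>)"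
    using edge[of "Suc t"] by (simp add: insert_commute)
  consider "m = 0" | "m = 1" | n where "m = Suc (Suc n)"
    by (metis One_nat_def not0_implies_Suc)
  then show ?thesis
  proof cases
    case 1
    then show ?thesis using True v by (simp add: jump_def)
  next
    case 2
    have "coord (u (Suc (Suc t))) (Some []) - coord (u t) (Some []) =
        (coord (u (Suc (Suc t))) (Some []) + coord (u (Suc t)) (Some [])) -
        (coord (u t) (Some []) + coord (u (Suc t)) (Some []))" by simp
    also have "\<dots> = jump t * colour (u (Suc t))"
      unfolding edge_Nil[OF e1] edge_Nil[OF e2] by (simp add: jump_def algebra_simps)
    finally show ?thesis using 2 True v by (simp add: algebra_simps)
  next
    case 3
    then have w: "altw (\<not> b) n @ [b] \<in> \<Omega>" using assms by simp
    let ?c = "\<lambda>t. coord (u t) (Some (altw b (Suc n)))"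
    have "?c (Suc (Suc t)) - ?c t = (?c (Suc (Suc t)) + ?c (Suc t)) - (?c t + ?c (Suc t))"
      by simp
    also have "\<dots> = jump t * coord (u (Suc t)) (Some (altw (\<not> b) n))"
      using edge_snoc[OF e1, folded b(1), OF w] edge_snoc[OF e2, folded b(2), OF w]
      by (simp add: jump_def algebra_simps)
    finally show ?thesis using 3 True v by (simp add: algebra_simps)
  qed
qed

text \<open>The recursion of \<open>level_Suc\<close> is that of the iterated sums, except that the levels need not
  start at zero; unfolding it collects the initial value of each level on the way down, followed
  by the jumps made above it.\<close>

lemma level_expansion:
  assumes "altw b (m - 2) \<in> \<Omega>"
  shows "level b m t = (\<Sum>i\<le>m. level (b = even i) (m - i) 0 * itsum s jump b i t)"
  using assms
proof (induction t arbitrary: b m)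
  case 0
  have "(\<Sum>i\<le>m. level (b = even i) (m - i) 0 * itsum s jump b i 0) =
      (\<Sum>i\<le>m. if i = 0 then level b m 0 else 0)"
    by (intro sum.cong) (auto simp: gr0_conv_Suc)
  then show ?case by simp
next
  case (Suc t)
  show ?case
  proof (cases m)
    case (Suc n)
    have "altw (\<not> b) (n - 2) \<in> \<Omega>"
    proof (cases "n \<le> 2")
      case True
      then show ?thesis using C1 by (simp add: C1_def)
    next
      case False
      then have "m - 2 = Suc (n - 2)" using Suc by simp
      then show ?thesis using altw_prefix C1 Suc.prems by metis
    qed
    note IH = Suc.IH[OF this] Suc.IH[OF Suc.prems]
    have flip: "((\<not> b) = even i) = (b = even (Suc i))" for i by auto
    have "level b m (Suc t) = level b m t +
        (if b = (s = even t) then jump t * level (\<not> b) n t else 0)"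
      using level_Suc[of b n t] Suc Suc.prems by simp
    also have "\<dots> = (\<Sum>i\<le>m. level (b = even i) (m - i) 0 * itsum s jump b i (Suc t))"
    proof (cases "b = (s = even t)")
      case True
      have step: "itsum s jump b (Suc i) (Suc t) =
          itsum s jump b (Suc i) t + jump t * itsum s jump (\<not> b) i t" for i
        unfolding itsum.simps if_P[OF True] ..
      show ?thesis
        unfolding IH if_P[OF True] flip
        unfolding Suc sum.atMost_Suc_shift step
        by (simp only: sum.distrib sum_distrib_left distrib_left diff_Suc_Suc itsum.simps(1))
          (simp only: ac_simps)
    next
      case False
      then have "itsum s jump b i (Suc t) = itsum s jump b i t" for i
        by (cases i) (simp_all only: itsum.simps if_False add_0_right)
      then show ?thesis unfolding IH if_not_P[OF False] by simp
    qed
    finally show ?thesis .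
  qed simp
qed

lemma turn_relation:
  assumes "altw b (m - 2) \<in> \<Omega>"
  shows "(\<Sum>i=1..m. level (b = even i) (m - i) 0 * itsum s jump b i T) = 0"
proof -
  have "{..m} = insert 0 {1..m}" by auto
  then have "level b m T = level b m 0 +
      (\<Sum>i=1..m. level (b = even i) (m - i) 0 * itsum s jump b i T)"
    using level_expansion[OF assms, of T] by simp
  then show ?thesis using level_closed by simp
qed

text \<open>In the relation of depth \<open>i\<close> the sum of depth \<open>i\<close> has the coefficient 1, and all other
  terms are sums of smaller depth.\<close>

lemma itsum_turn_eq_0:
  assumes "\<And>m. m \<le> n \<Longrightarrow> altw b m \<in> \<Omega>"
  shows "1 \<le> i \<Longrightarrow> i \<le> n + 2 \<Longrightarrow> itsum s jump b i T = 0"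
proof (induction i rule: less_induct)
  case (less i)
  have "{1..i} = insert i {1..<i}" using less.prems by auto
  then have "0 = itsum s jump b i T +
      (\<Sum>j=1..<i. level (b = even j) (i - j) 0 * itsum s jump b j T)"
    using turn_relation[of b i] assms[of "i - 2"] less.prems by simp
  then show ?case using less by simp
qed

text \<open>The sums of depth below \<open>i\<close> belong to words of length at most \<open>i - 3\<close>, which arise from the
  given word by deleting at least two bits. The two remaining terms have the coefficients
  \<open>level _ 0 0 = 1\<close> and \<open>level _ 1 0\<close>; the latter is the colour of \<open>u 1\<close> because of the choice
  of the last bit.\<close>

lemma turn_leading_relation:
  assumes "SS \<Omega> \<subseteq> \<Omega>" "altw (s = odd i) (i - 1) \<in> \<Omega>" "1 \<le> i"
  shows "itsum s jump (s = odd i) (Suc i) T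
    + colour (u 1) * itsum s jump (s = odd i) i T = 0"
proof -
  let ?b = "s = odd i"
  have "altw ?b m \<in> \<Omega>" if "m \<le> i - 3" for m
  proof (cases "m = 0")
    case True
    then show ?thesis using C1 by (simp add: C1_def)
  next
    case False
    then show ?thesis using altw_suffix[OF C1 assms(1,2), of m] that by simp
  qed
  then have 0: "itsum s jump ?b j T = 0" if "1 \<le> j" "j < i" for j
    using itsum_turn_eq_0[of "i - 3" ?b j] that by simp
  have "{1..Suc i} = insert (Suc i) (insert i {1..<i})" using assms(3) by auto
  moreover have "vert (?b = even i) 0 = u 1" by (auto simp: vert_def isl_u)
  ultimately show ?thesis
    using turn_relation[of ?b "Suc i"] assms(2) by (simp add: 0 Suc_diff_le)
qed

end

text \<open>The levels 1 to \<open>k\<close> of the contradiction come from the prefixes of a single alternating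
  word of length \<open>k - 1\<close>. Its last bit fixes on which side the walk has to start.\<close>

lemma no_short_closed_walk:
  assumes "closed_walk \<Omega> u (2 * k) s" and S: "SS \<Omega> \<subseteq> \<Omega>"
    and "altw (s = odd k) (k - 1) \<in> \<Omega>" and "k \<ge> 1"
    and c: "colour (u 1) \<noteq> 0" and nb: "\<And>t. u (Suc (Suc t)) \<noteq> u t"
  shows False
proof -
  interpret closed_walk \<Omega> u "2 * k" s by fact
  have w: "altw (s = odd i) (i - 1) \<in> \<Omega>" if "1 \<le> i" "i \<le> k" for i
    using that(2,1)
  proof (induction rule: inc_induct)
    case (step i)
    then have "altw (s = odd (Suc i)) (Suc (i - 1)) \<in> \<Omega>" by simp
    then have "altw (\<not> (s = odd (Suc i))) (i - 1) \<in> \<Omega>" using altw_prefix C1 by blast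
    moreover have "(\<not> (s = odd (Suc i))) = (s = odd i)" by auto
    ultimately show ?case by simp
  qed (use assms(3) in simp)
  have "jump t \<noteq> 0" for t
  proof
    assume "jump t = 0"
    then have "u (Suc (Suc t)) = u t"
      using neighbour_eqI[OF C1, of "u (Suc (Suc t))" "u (Suc t)" "u t"] edge[of t] edge[of "Suc t"]
      by (simp add: jump_def insert_commute)
    then show False using nb by blast
  qed
  then show False
    using midpoint_contradiction[of k s jump "colour (u 1)"] turn_leading_relation[OF S w] assms(4) c by blast
qed

section \<open>Cycles\<close>

text \<open>
  A cycle has even length, as its edges change sides, so a short one has length \<open>2 * k\<close> with
  \<open>k \<le> n + 1\<close>. The remaining freedom is the starting point of the walk around it: the side of
  \<open>u 1\<close> is prescribed, but two consecutive vertices of that side have different colours, so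
  that one of them is not zero.
\<close>

lemma no_short_cycle:
  fixes p :: "('a::field vec + 'a vec) list"
  assumes C1: "C1 \<Omega>" and S: "SS \<Omega> \<subseteq> \<Omega>" and p: "is_cycle (Gamma \<Omega>) p"
    and w: "altw b n \<in> \<Omega>"
  shows "2 * (n + 2) \<le> length p"
proof (rule ccontr)
  assume short: "\<not> 2 * (n + 2) \<le> length p"
  define N where "N = length p"
  have N: "N \<ge> 3" and dist: "distinct p"
    and e: "\<And>i. i < N \<Longrightarrow> {p ! i, p ! (Suc i mod N)} \<in> edges (Gamma \<Omega>)"
    using p by (auto simp: is_cycle_def N_def)
  define v where "v t = p ! (t mod N)" for t
  have per: "v (t + N) = v t" for t by (simp add: v_def)
  have edge: "{v t, v (Suc t)} \<in> edges (Gamma \<Omega>)" for t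
    using e[of "t mod N"] N by (simp add: v_def mod_Suc_eq)
  have isl: "isl (v t) = (isl (v 0) = even t)" for t
    by (induction t) (use edge_isl[OF edge] in auto)
  have "even N" using isl[of N] per[of 0] by auto
  then obtain k where k: "N = 2 * k" by blast
  have "k \<ge> 2" "k \<le> n + 1" using k N short by (auto simp: N_def)
  have nb: "v (Suc (Suc t)) \<noteq> v t" for t
  proof
    assume "v (Suc (Suc t)) = v t"
    then have "p ! ((t + 2) mod N) = p ! ((t + 0) mod N)" by (simp add: v_def)
    moreover have "(t + 2) mod N < length p" "(t + 0) mod N < length p"
      using N by (simp_all only: N_def[symmetric] mod_less_divisor)
    ultimately have "(t + 2) mod N = (t + 0) mod N" using nth_eq_iff_index_eq[OF dist] by blast
    then have "N dvd (t + 2) - (t + 0)" by (intro mod_eq_dvd_iff_nat[THEN iffD1]) auto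
    then show False using N by (auto dest: dvd_imp_le)
  qed
  have word: "\<exists>d. altw d j \<in> \<Omega>" if "j \<le> n" for j
    using that
  proof (induction rule: inc_induct)
    case base
    then show ?case using w by blast
  next
    case (step j)
    then show ?case using altw_prefix C1 by blast
  qed
  then obtain d where d: "altw d (k - 1) \<in> \<Omega>" using \<open>k \<le> n + 1\<close> by (meson le_diff_conv)
  define s where "s = (d = odd k)"
  obtain q0 where q0: "isl (v q0) = (\<not> s)" using isl[of 0] isl[of 1] by fastforce
  have "colour (v (Suc (Suc q0))) \<noteq> colour (v q0)"
    using neighbour_eqI[OF C1, of "v (Suc (Suc q0))" "v (Suc q0)" "v q0"] nb
      edge[of q0] edge[of "Suc q0"] by (auto simp: insert_commute)
  then obtain q where q: "isl (v q) = (\<not> s)" "colour (v q) \<noteq> 0"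
    using q0 isl[of q0] isl[of "Suc (Suc q0)"] by (metis even_Suc)
  \<comment> \<open>The walk starts one step before \<open>v q\<close>; a full turn is added to keep the index natural.\<close>
  define u where "u t = v (q + N - 1 + t)" for t
  have u1: "u 1 = v q" using N per[of q] by (simp add: u_def)
  have "closed_walk \<Omega> u (2 * k) s"
  proof
    show "isl (u t) = (s = even t)" for t
    proof -
      have "isl (u t) = (isl (v 0) = (even (q + N - 1) = even t))"
        unfolding u_def by (subst isl) auto
      moreover have "even (q + N - 1) = odd q" using k N by auto
      ultimately show ?thesis using q(1) isl[of q] by auto
    qed
    show "{u t, u (Suc t)} \<in> edges (Gamma \<Omega>)" for t
      using edge[of "q + N - 1 + t"] by (simp add: u_def)
    show "u (t + 2 * k) = u t" for t
      using per[of "q + N - 1 + t"] k by (simp add: u_def add.assoc)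
  qed (fact C1)
  moreover have "altw (s = odd k) (k - 1) \<in> \<Omega>" 
  proof -
    have "(s = odd k) = d" by (auto simp: s_def)
    then show ?thesis using d by simp
  qed
  moreover have "u (Suc (Suc t)) \<noteq> u t" for t
    using nb[of "q + N - 1 + t"] by (simp add: u_def)
  ultimately show False
    using no_short_closed_walk[of \<Omega> u k s] S u1 q(2) \<open>k \<ge> 2\<close> by auto
qed

theorem theorem8:
  fixes \<Omega> :: "binseq set" and \<beta> :: binseq
  assumes "finite \<Omega>" and "C1 \<Omega>"
    and "SS \<Omega> \<subseteq> \<Omega>"
    and "\<beta> \<in> \<Omega> \<inter> U"
  shows "girth (Gamma \<Omega> :: ('a::{field, finite} vec + 'a vec) graph) \<ge> enat (2 * (length \<beta> + 2))"
proof -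
  obtain b where "altw b (length \<beta>) \<in> \<Omega>" using altw_of_U assms(4) by (metis IntE)
  then have "2 * (length \<beta> + 2) \<le> length p"
    if "is_cycle (Gamma \<Omega>) p" for p :: "('a vec + 'a vec) list"
    using no_short_cycle[OF assms(2,3) that] by blast
  then show ?thesis
    unfolding girth_def by (intro INF_greatest) simp
qed

end
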